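(* Let $A$ be an $m\times n$ totally unimodular matrix and $\vec b,\vec c\in\mathbb Z^m$, and suppose $\mathcal P(A,\vec b)$ is bounded. Then there is a polynomial $f$ with $\deg f\le n$ such that $N(A,\vec b k+\vec c)=f(k)$ for all sufficiently large integers $k$. If moreover $\dim\mathcal P(A,\vec b)=n$ and no row of $A$ is zero, then $\deg f=n$ and the leading coefficient of $f$ is the volume of $\mathcal P(A,\vec b)$.
   Context: For an $m\times n$ real matrix $A$ and $\vec b\in\mathbb R^m$, $\mathcal P(A,\vec b)=\{\vec x\in\mathbb R^n : A\vec x\le\vec b,\ \vec x\ge 0\}$ (inequalities componentwise), and $N(A,\vec b)$ is the number of points of $\mathbb Z^n$ in $\mathcal P(A,\vec b)$. A matrix is totally unimodular if every square submatrix has determinant $0$, $1$ or $-1$. The dimension of a polytope is the dimension of its affine span. *)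

theory Defs
  imports "HOL-Analysis.Analysis" "HOL-Computational_Algebra.Polynomial"
begin

definition sq_det :: "nat \<Rightarrow> (nat \<Rightarrow> nat \<Rightarrow> real) \<Rightarrow> real" where
  "sq_det k M = (\<Sum>p\<in>{p. p permutes {..<k}}. of_int (sign p) * (\<Prod>i<k. M i (p i)))"

text \<open>Totally unimodular: every square submatrix (rows r 0..r (k-1), columns c 0..c (k-1),
  pairwise distinct) has determinant 0, 1 or -1. Allowing arbitrary orderings of the chosen
  rows/columns only changes the sign of the determinant, so this is the usual notion.\<close>
definition totally_unimodular :: "real^'n^'m \<Rightarrow> bool" where
  "totally_unimodular A \<longleftrightarrow>
     (\<forall>k (r::nat \<Rightarrow> 'm) (c::nat \<Rightarrow> 'n). inj_on r {..<k} \<and> inj_on c {..<k} \<longrightarrow>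
        sq_det k (\<lambda>i j. A $ r i $ c j) \<in> {-1, 0, 1})"

definition polyP :: "real^'n^'m \<Rightarrow> real^'m \<Rightarrow> (real^'n) set" where
  "polyP A b = {x. (\<forall>i. (A *v x) $ i \<le> b $ i) \<and> (\<forall>j. 0 \<le> x $ j)}"

definition latN :: "real^'n^'m \<Rightarrow> real^'m \<Rightarrow> nat" where
  "latN A b = card (polyP A b \<inter> {x. \<forall>j. x $ j \<in> \<int>})"

end

theory Submission
  imports Defs "Jordan_Normal_Form.Determinant"
begin

text \<open>With slack variables, the lattice points of \<open>P(A, v)\<close> are the representations of \<open>v\<close> as a
  nonnegative integral combination of the columns of \<open>[A I]\<close>. Let \<open>N\<^sub>S(v)\<close> be the number of
  those that only use a set \<open>S\<close> of columns. Removing one copy of the column \<open>g\<close> shows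
  \<open>N\<^sub>S(v + g) - N\<^sub>S(v) = N\<^sub>S\<^sub>-\<^sub>g(v + g)\<close>. By total unimodularity, \<open>b\<close> is an integral combination of
  the columns in \<open>S\<close> as soon as it is a real one. Then \<open>N\<^sub>S(k b + b + c) - N\<^sub>S(k b + c)\<close> telescopes
  into terms \<open>\<plusminus>N\<^sub>S\<^sub>-\<^sub>g(k b + c')\<close>, which are eventually polynomial in \<open>k\<close> by induction on \<open>S\<close>,
  hence so is \<open>N\<^sub>S(k b + c)\<close>. The degree and the leading coefficient follow by comparing
  \<open>N(A, k b + c)\<close> with the volumes of slightly enlarged and slightly shrunk copies of
  \<open>k P(A, b)\<close>.\<close>

no_notation Matrix.vec_index (infixl "$" 100)

subsection \<open>Eventually polynomial sequences\<close>

text \<open>The binomial expansion of \<open>(x + 1) ^ Suc n - x ^ Suc n\<close> is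
  \<open>Suc n * x ^ n\<close> plus lower powers. Antidifferences of the lower powers exist by
  strong induction; they are subtracted from the monomial and the result is divided by
  \<open>Suc n\<close>.\<close>

lemma monom_antidifference:
  "\<exists>q::real poly. \<forall>x. poly q (x + 1) - poly q x = x ^ n"
proof (induction n rule: less_induct)
  case (less n)
  then obtain q :: "nat \<Rightarrow> real poly"
    where q: "\<And>k x. k < n \<Longrightarrow> poly (q k) (x + 1) - poly (q k) x = x ^ k"
    by metis
  define r where "r = Polynomial.smult (1 / real (Suc n))
    (monom 1 (Suc n) - (\<Sum>k<n. Polynomial.smult (real (Suc n choose k)) (q k)))"
  have "poly r (x + 1) - poly r x = x ^ n" for x
  proof -
    have "(x + 1) ^ Suc n = (\<Sum>k<n. real (Suc n choose k) * x ^ k) + real (Suc n) * x ^ n + x ^ Suc n"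
      using binomial_ring[of x 1 "Suc n"]
      by (simp add: atMost_Suc lessThan_Suc_atMost[symmetric] lessThan_Suc algebra_simps)
    moreover have "(\<Sum>k<n. real (Suc n choose k) * poly (q k) (x + 1)) -
        (\<Sum>k<n. real (Suc n choose k) * poly (q k) x) = (\<Sum>k<n. real (Suc n choose k) * x ^ k)"
      unfolding sum_subtractf[symmetric] by (intro sum.cong) (auto simp: q right_diff_distrib[symmetric])
    ultimately have "real (Suc n) * (poly r (x + 1) - poly r x) = real (Suc n) * x ^ n"
      by (simp add: r_def poly_monom poly_sum field_simps del: of_nat_Suc power_Suc)
    then show ?thesis
      by (simp del: of_nat_Suc)
  qed
  then show ?case by blast
qed

lemma poly_antidifference:
  "\<exists>q::real poly. \<forall>x. poly q (x + 1) - poly q x = poly p x"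
proof -
  obtain q :: "nat \<Rightarrow> real poly" where q: "\<And>n x. poly (q n) (x + 1) - poly (q n) x = x ^ n"
    using monom_antidifference by metis
  have "poly (\<Sum>i\<le>degree p. Polynomial.smult (coeff p i) (q i)) (x + 1) -
      poly (\<Sum>i\<le>degree p. Polynomial.smult (coeff p i) (q i)) x = poly p x" for x
    unfolding poly_sum poly_smult sum_subtractf[symmetric] right_diff_distrib[symmetric] q
    by (simp add: poly_altdef)
  then show ?thesis by blast
qed

definition eventually_poly :: "(nat \<Rightarrow> real) \<Rightarrow> bool" where
  "eventually_poly f \<longleftrightarrow> (\<exists>p. \<forall>\<^sub>F k in sequentially. f k = poly p (real k))"

lemma eventually_poly_cong:
  assumes "\<forall>\<^sub>F k in sequentially. f k = g k" and "eventually_poly g"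
  shows "eventually_poly f"
proof -
  from assms(2) obtain p where "\<forall>\<^sub>F k in sequentially. g k = poly p (real k)"
    unfolding eventually_poly_def by blast
  with assms(1) have "\<forall>\<^sub>F k in sequentially. f k = poly p (real k)"
    by eventually_elim simp
  then show ?thesis unfolding eventually_poly_def by blast
qed

lemma eventually_poly_0 [simp]: "eventually_poly (\<lambda>k. 0)"
  unfolding eventually_poly_def by (rule exI[of _ 0]) simp

lemma eventually_poly_add:
  assumes "eventually_poly f" "eventually_poly g"
  shows "eventually_poly (\<lambda>k. f k + g k)"
proof -
  from assms obtain p q where "\<forall>\<^sub>F k in sequentially. f k = poly p (real k)"
    and "\<forall>\<^sub>F k in sequentially. g k = poly q (real k)"
    unfolding eventually_poly_def by blast
  then have "\<forall>\<^sub>F k in sequentially. f k + g k = poly (p + q) (real k)"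
    by eventually_elim simp
  then show ?thesis unfolding eventually_poly_def by blast
qed

lemma eventually_poly_uminus:
  assumes "eventually_poly f"
  shows "eventually_poly (\<lambda>k. - f k)"
proof -
  from assms obtain p where "\<forall>\<^sub>F k in sequentially. f k = poly p (real k)"
    unfolding eventually_poly_def by blast
  then have "\<forall>\<^sub>F k in sequentially. - f k = poly (- p) (real k)"
    by eventually_elim simp
  then show ?thesis unfolding eventually_poly_def by blast
qed

text \<open>From \<open>K\<close> on, \<open>f\<close> and a polynomial antidifference
  \<open>q\<close> have the same increments, so they differ by the constant
  \<open>f K - poly q (real K)\<close>.\<close>

lemma eventually_poly_antidifference:
  assumes "eventually_poly (\<lambda>k. f (Suc k) - f k)"
  shows "eventually_poly f"
proof -
  from assms obtain p K where p: "\<And>k. k \<ge> K \<Longrightarrow> f (Suc k) - f k = poly p (real k)"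
    unfolding eventually_poly_def eventually_sequentially by blast
  obtain q :: "real poly" where q: "\<And>x. poly q (x + 1) - poly q x = poly p x"
    using poly_antidifference by blast
  have "f k = poly (q + [:f K - poly q (real K):]) (real k)" if "k \<ge> K" for k
    using that
  proof (induction k rule: dec_induct)
    case (step k)
    then show ?case using p[of k] q[of "real k"] by (simp add: add.commute)
  qed simp
  then show ?thesis unfolding eventually_poly_def eventually_sequentially by blast
qed

subsection \<open>Counting nonnegative integral representations\<close>

text \<open>Forcing \<open>y\<close> to vanish outside \<open>S\<close> makes each choice of
  coefficients on \<open>S\<close> a single function, so that cardinalities count
  representations.\<close>

definition reps :: "('i \<Rightarrow> 'v::real_vector) \<Rightarrow> 'i set \<Rightarrow> 'v \<Rightarrow> ('i \<Rightarrow> nat) set" where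
  "reps g S v = {y. (\<forall>i. i \<notin> S \<longrightarrow> y i = 0) \<and> (\<Sum>i\<in>S. real (y i) *\<^sub>R g i) = v}"

lemma sum_scaleR_fun_upd:
  fixes g :: "'i \<Rightarrow> 'v::real_vector"
  assumes "finite S" "j \<in> S"
  shows "(\<Sum>i\<in>S. real ((y(j := n)) i) *\<^sub>R g i) =
    (\<Sum>i\<in>S. real (y i) *\<^sub>R g i) + (real n - real (y j)) *\<^sub>R g j"
  using assms by (simp add: sum.remove[of S j] scaleR_left_diff_distrib)

text \<open>Representations of \<open>v + g j\<close> are split by whether \<open>y j\<close> is
  zero. Incrementing coordinate \<open>j\<close> matches those of \<open>v\<close> with the nonzero
  case; the zero case does without \<open>g j\<close>.\<close>

lemma card_reps_delete:
  fixes g :: "'i \<Rightarrow> 'v::real_vector"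
  assumes S: "finite S" "j \<in> S" and fin: "finite (reps g S (v + g j))"
  shows "card (reps g S (v + g j)) = card (reps g S v) + card (reps g (S - {j}) (v + g j))"
proof -
  let ?up = "\<lambda>y. y(j := Suc (y j))"
  let ?dn = "\<lambda>y. y(j := y j - 1)"
  have pos: "bij_betw ?up (reps g S v) {y \<in> reps g S (v + g j). y j \<noteq> 0}"
  proof (rule bij_betw_byWitness[where f' = ?dn])
    show "?up ` reps g S v \<subseteq> {y \<in> reps g S (v + g j). y j \<noteq> 0}"
    proof (rule image_subsetI)
      fix y assume y: "y \<in> reps g S v"
      then have "(\<Sum>i\<in>S. real (?up y i) *\<^sub>R g i) = v + g j"
        using S unfolding reps_def by (subst sum_scaleR_fun_upd) auto
      with y S show "?up y \<in> {y \<in> reps g S (v + g j). y j \<noteq> 0}"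
        unfolding reps_def by fastforce
    qed
    show "?dn ` {y \<in> reps g S (v + g j). y j \<noteq> 0} \<subseteq> reps g S v"
    proof (rule image_subsetI)
      fix y assume y: "y \<in> {y \<in> reps g S (v + g j). y j \<noteq> 0}"
      then have "(\<Sum>i\<in>S. real (?dn y i) *\<^sub>R g i) = v"
        using S unfolding reps_def by (subst sum_scaleR_fun_upd) (auto simp: of_nat_diff)
      with y S show "?dn y \<in> reps g S v"
        unfolding reps_def by fastforce
    qed
  qed auto
  have zero: "{y \<in> reps g S (v + g j). y j = 0} = reps g (S - {j}) (v + g j)"
    using S by (auto simp: reps_def sum.remove[of S j])
  have "reps g S (v + g j) = {y \<in> reps g S (v + g j). y j \<noteq> 0} \<union> {y \<in> reps g S (v + g j). y j = 0}"
    by auto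
  also have "card \<dots> = card {y \<in> reps g S (v + g j). y j \<noteq> 0} + card {y \<in> reps g S (v + g j). y j = 0}"
    using fin by (intro card_Un_disjoint) auto
  also have "\<dots> = card (reps g S v) + card (reps g (S - {j}) (v + g j))"
    using bij_betw_same_card[OF pos] zero by simp
  finally show ?thesis .
qed

lemma reps_mono:
  assumes "T \<subseteq> S" "finite S"
  shows "reps g T v \<subseteq> reps g S v"
proof
  fix y assume y: "y \<in> reps g T v"
  then have "(\<Sum>i\<in>T. real (y i) *\<^sub>R g i) = (\<Sum>i\<in>S. real (y i) *\<^sub>R g i)"
    using assms by (intro sum.mono_neutral_left) (auto simp: reps_def)
  with y assms(1) show "y \<in> reps g S v"
    by (auto simp: reps_def)
qed

text \<open>Induction on \<open>S\<close> with \<open>c\<close> arbitrary, because deleting a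
  generator shifts the offset. The integrality condition ranges over all
  \<open>T \<subseteq> S\<close>, so smaller sets inherit it.\<close>

lemma eventually_poly_card_reps:
  fixes g :: "'i \<Rightarrow> 'v::real_vector"
  assumes "finite S"
    and "\<And>v. finite (reps g S v)"
    and "\<And>T u. T \<subseteq> S \<Longrightarrow> b = (\<Sum>i\<in>T. u i *\<^sub>R g i) \<Longrightarrow> \<exists>z. b = (\<Sum>i\<in>T. of_int (z i) *\<^sub>R g i)"
  shows "eventually_poly (\<lambda>k. real (card (reps g S (real k *\<^sub>R b + c))))"
  using assms
proof (induction S arbitrary: c rule: finite_psubset_induct)
  case (psubset S)
  let ?N = "\<lambda>v. real (card (reps g S v))"
  \<comment> \<open>\<open>D\<close> holds of those shifts that change the count by an eventually
    polynomial amount, whatever the offset. They form an additive group, which contains every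
    \<open>g j\<close> by the induction hypothesis and hence all integral combinations.\<close>
  define D where "D = (\<lambda>u. \<forall>c. eventually_poly (\<lambda>k. ?N (real k *\<^sub>R b + c + u) - ?N (real k *\<^sub>R b + c)))"
  have D_0: "D 0" by (simp add: D_def)
  have D_add: "D (u + w)" if "D u" "D w" for u w
    unfolding D_def
  proof
    fix c
    have "eventually_poly (\<lambda>k. (?N (real k *\<^sub>R b + (c + u) + w) - ?N (real k *\<^sub>R b + (c + u))) +
        (?N (real k *\<^sub>R b + c + u) - ?N (real k *\<^sub>R b + c)))"
      using that unfolding D_def by (intro eventually_poly_add) blast+
    then show "eventually_poly (\<lambda>k. ?N (real k *\<^sub>R b + c + (u + w)) - ?N (real k *\<^sub>R b + c))"
      by (simp add: add.assoc)
  qed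
  have D_uminus: "D (- u)" if "D u" for u
    unfolding D_def
  proof
    fix c
    \<comment> \<open>Shifting by \<open>- u\<close> from \<open>c\<close> reverses the shift by
      \<open>u\<close> from \<open>c - u\<close>.\<close>
    have "eventually_poly (\<lambda>k. - (?N (real k *\<^sub>R b + (c - u) + u) - ?N (real k *\<^sub>R b + (c - u))))"
      using that unfolding D_def by (intro eventually_poly_uminus) blast
    then show "eventually_poly (\<lambda>k. ?N (real k *\<^sub>R b + c + - u) - ?N (real k *\<^sub>R b + c))"
      by (simp add: algebra_simps)
  qed
  have D_nat: "D (real n *\<^sub>R u)" if "D u" for u n
    by (induction n) (auto simp: D_0 scaleR_left_distrib intro: D_add that)
  have D_int: "D (of_int z *\<^sub>R u)" if "D u" for u z
    using that by (cases z rule: int_cases2) (auto intro: D_nat D_uminus)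
  have D_g: "D (g j)" if "j \<in> S" for j
    unfolding D_def
  proof
    fix c
    have "eventually_poly (\<lambda>k. real (card (reps g (S - {j}) (real k *\<^sub>R b + (c + g j)))))"
    proof (rule psubset.IH)
      show "finite (reps g (S - {j}) v)" for v
        using reps_mono[of "S - {j}" S g v] psubset.hyps psubset.prems(1) finite_subset by blast
    next
      show "\<exists>z. b = (\<Sum>i\<in>T. of_int (z i) *\<^sub>R g i)"
        if "T \<subseteq> S - {j}" "b = (\<Sum>i\<in>T. u i *\<^sub>R g i)" for T u
        using psubset.prems(2)[of T u] that by blast
    qed (use that in auto)
    moreover have "?N (v + g j) - ?N v = real (card (reps g (S - {j}) (v + g j)))" for v
      using card_reps_delete[OF \<open>finite S\<close> that psubset.prems(1), of v] by simp
    ultimately show "eventually_poly (\<lambda>k. ?N (real k *\<^sub>R b + c + g j) - ?N (real k *\<^sub>R b + c))"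
      by (simp flip: add.assoc)
  qed
  show ?case
  proof (cases "\<exists>u. b = (\<Sum>i\<in>S. u i *\<^sub>R g i)")
    case True
    then obtain z where z: "b = (\<Sum>i\<in>S. of_int (z i) *\<^sub>R g i)"
      using psubset.prems(2) by blast
    have "D (\<Sum>i\<in>T. of_int (z i) *\<^sub>R g i)" if "T \<subseteq> S" for T
      using finite_subset[OF that \<open>finite S\<close>] that
      by (induction T rule: finite_induct) (auto intro: D_0 D_add D_int D_g)
    with z have "D b" by simp
    then have "eventually_poly (\<lambda>k. ?N (real k *\<^sub>R b + c + b) - ?N (real k *\<^sub>R b + c))"
      unfolding D_def by blast
    \<comment> \<open>A shift by \<open>b\<close> is the passage from \<open>k\<close> to
      \<open>Suc k\<close>.\<close>
    then have "eventually_poly (\<lambda>k. ?N (real (Suc k) *\<^sub>R b + c) - ?N (real k *\<^sub>R b + c))"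
      by (simp add: algebra_simps)
    then show ?thesis
      by (rule eventually_poly_antidifference)
  next
    case False
    \<comment> \<open>at most one of the vectors \<open>k b + c\<close> can then be representable\<close>
    have comb: "\<exists>u. v = (\<Sum>i\<in>S. u i *\<^sub>R g i)" if "reps g S v \<noteq> {}" for v
    proof -
      from that obtain y where "y \<in> reps g S v" by blast
      then have "v = (\<Sum>i\<in>S. real (y i) *\<^sub>R g i)" by (simp add: reps_def)
      then show ?thesis by (rule exI[where x = "\<lambda>i. real (y i)"])
    qed
    have unique: "k = l" if kl: "reps g S (real k *\<^sub>R b + c) \<noteq> {}" "reps g S (real l *\<^sub>R b + c) \<noteq> {}" for k l
    proof (rule ccontr)
      assume "k \<noteq> l"
      obtain u w where "real k *\<^sub>R b + c = (\<Sum>i\<in>S. u i *\<^sub>R g i)"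
        and "real l *\<^sub>R b + c = (\<Sum>i\<in>S. w i *\<^sub>R g i)"
        using comb[OF kl(1)] comb[OF kl(2)] by blast
      \<comment> \<open>Subtracting the two combinations eliminates \<open>c\<close>; dividing by
        \<open>k - l\<close> then exhibits \<open>b\<close> as a real combination, against the case
        assumption.\<close>
      then have "(real k *\<^sub>R b + c) - (real l *\<^sub>R b + c) = (\<Sum>i\<in>S. (u i - w i) *\<^sub>R g i)"
        by (simp only: scaleR_left_diff_distrib sum_subtractf)
      then have "(real k - real l) *\<^sub>R b = (\<Sum>i\<in>S. (u i - w i) *\<^sub>R g i)"
        by (simp add: algebra_simps)
      then have "(1 / (real k - real l)) *\<^sub>R (real k - real l) *\<^sub>R b =
          (\<Sum>i\<in>S. (1 / (real k - real l) * (u i - w i)) *\<^sub>R g i)"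
        by (simp only: scaleR_sum_right scaleR_scaleR)
      with \<open>k \<noteq> l\<close> have "b = (\<Sum>i\<in>S. (1 / (real k - real l) * (u i - w i)) *\<^sub>R g i)"
        by simp
      with False[unfolded not_ex, rule_format, of "\<lambda>i. 1 / (real k - real l) * (u i - w i)"]
      show False by contradiction
    qed
    have "\<forall>\<^sub>F k in sequentially. reps g S (real k *\<^sub>R b + c) = {}"
    proof (cases "\<exists>l. reps g S (real l *\<^sub>R b + c) \<noteq> {}")
      case True
      then obtain l where "reps g S (real l *\<^sub>R b + c) \<noteq> {}" by blast
      with unique have "reps g S (real k *\<^sub>R b + c) = {}" if "k > l" for k
        using that by blast
      then show ?thesis
        by (rule eventually_mono[OF eventually_gt_at_top[of l]])
    qed simp
    then have "\<forall>\<^sub>F k in sequentially. ?N (real k *\<^sub>R b + c) = 0"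
      by eventually_elim simp
    then show ?thesis by (rule eventually_poly_cong) simp
  qed
qed

subsection \<open>Integral solutions of totally unimodular systems\<close>

text \<open>Gives access to Laplace expansion and the adjugate for \<open>sq_det\<close>.\<close>

lemma sq_det_eq_det: "sq_det k M = Determinant.det (Matrix.mat k k (\<lambda>(i, j). M i j))"
  unfolding sq_det_def Determinant.det_def
  by (auto simp: lessThan_atLeast0 intro!: sum.cong prod.cong dest: permutes_in_image)

lemma sq_det_in_Ints:
  assumes "\<And>i j. i < k \<Longrightarrow> j < k \<Longrightarrow> M i j \<in> \<int>"
  shows "sq_det k M \<in> \<int>"
  unfolding sq_det_def
  by (intro Ints_sum Ints_mult Ints_prod) (auto intro: assms dest: permutes_in_image)

text \<open>Laplace expansion. The corner term is kept apart because its cofactor is the leading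
  minor of size \<open>k\<close>, with sign \<open>+1\<close>.\<close>

lemma sq_det_last_column:
  "sq_det (Suc k) M = (\<Sum>a<k. M a k * cofactor (Matrix.mat (Suc k) (Suc k) (\<lambda>(i, j). M i j)) a k)
    + M k k * sq_det k M"
proof -
  let ?B = "Matrix.mat (Suc k) (Suc k) (\<lambda>(i, j). M i j)"
  have "mat_delete ?B k k = Matrix.mat k k (\<lambda>(i, j). M i j)"
    by (auto simp: mat_delete_def)
  then have "cofactor ?B k k = sq_det k M"
    by (simp add: cofactor_def sq_det_eq_det)
  then show ?thesis
    using laplace_expansion_column[of ?B "Suc k" k] by (simp add: sq_det_eq_det)
qed

lemma sq_det_1: "sq_det (Suc 0) M = M 0 0"
  by (simp add: sq_det_last_column sq_det_def[of 0])

lemma sq_det_equal_columns: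
  assumes "a < k" "b < k" "a \<noteq> b" "\<And>i. i < k \<Longrightarrow> M i a = M i b"
  shows "sq_det k M = 0"
  unfolding sq_det_eq_det
  by (rule det_identical_columns[of _ k a b]) (use assms in \<open>auto simp: Matrix.col_def\<close>)

lemma sq_det_equal_rows:
  assumes "a < k" "b < k" "a \<noteq> b" "\<And>j. j < k \<Longrightarrow> M a j = M b j"
  shows "sq_det k M = 0"
  unfolding sq_det_eq_det
  by (rule det_identical_rows[of _ k a b]) (use assms in \<open>auto simp: Matrix.row_def\<close>)

text \<open>Cramer's rule: the adjugate of an integer matrix is integral, and dividing by a
  determinant \<open>1\<close> or \<open>-1\<close> keeps it so.\<close>

lemma unimodular_system_solvable:
  fixes M :: "nat \<Rightarrow> nat \<Rightarrow> real"
  assumes M: "\<And>i j. i < k \<Longrightarrow> j < k \<Longrightarrow> M i j \<in> \<int>"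
    and D: "sq_det k M = 1 \<or> sq_det k M = -1"
    and v: "\<And>i. i < k \<Longrightarrow> v i \<in> \<int>"
  obtains y :: "nat \<Rightarrow> real" where "\<And>j. y j \<in> \<int>"
    and "\<And>i. i < k \<Longrightarrow> (\<Sum>j<k. M i j * y j) = v i"
proof -
  let ?B = "Matrix.mat k k (\<lambda>(i, j). M i j)" and ?D = "sq_det k M"
  define N where "N = (\<lambda>i j. cofactor ?B j i)"
  have MN: "(\<Sum>l<k. M i l * N l j) = (if i = j then ?D else 0)" if "i < k" "j < k" for i j
  proof -
    have "(?B * adj_mat ?B) $$ (i, j) = (?D \<cdot>\<^sub>m 1\<^sub>m k) $$ (i, j)"
      using adj_mat(2)[of ?B k] by (simp add: sq_det_eq_det)
    then show ?thesis
      using that by (simp add: adj_mat_def N_def scalar_prod_def lessThan_atLeast0)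
  qed
  have N: "N i j \<in> \<int>" if "i < k" "j < k" for i j
  proof -
    have "mat_delete ?B j i = Matrix.mat (k - 1) (k - 1)
        (\<lambda>(i', j'). M (if i' < j then i' else Suc i') (if j' < i then j' else Suc j'))"
      by (auto simp: mat_delete_def)
    then have "N i j = (-1) ^ (j + i) * sq_det (k - 1)
        (\<lambda>i' j'. M (if i' < j then i' else Suc i') (if j' < i then j' else Suc j'))"
      by (simp add: N_def cofactor_def sq_det_eq_det)
    also have "\<dots> \<in> \<int>"
      by (intro Ints_mult Ints_power sq_det_in_Ints M) (use that in auto)
    finally show ?thesis .
  qed
  \<comment> \<open>The factor \<open>?D\<close> is its own inverse, so it replaces the division by
    the determinant. The default 0 makes \<open>y\<close> integral at every index.\<close>
  define y where "y = (\<lambda>j. if j < k then ?D * (\<Sum>i<k. N j i * v i) else 0)"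
  show thesis
  proof
    show "y j \<in> \<int>" for j
      using D by (auto simp: y_def intro!: Ints_sum Ints_mult N v)
    show "(\<Sum>j<k. M i j * y j) = v i" if "i < k" for i
    proof -
      have "(\<Sum>j<k. M i j * y j) = (\<Sum>j<k. \<Sum>l<k. ?D * v l * (M i j * N j l))"
        by (simp add: y_def sum_distrib_left mult_ac)
      also have "\<dots> = (\<Sum>l<k. ?D * v l * (\<Sum>j<k. M i j * N j l))"
        by (subst sum.swap) (simp add: sum_distrib_left)
      also have "\<dots> = (\<Sum>l<k. if l = i then ?D * ?D * v i else 0)"
        using that by (intro sum.cong) (auto simp: MN)
      also have "\<dots> = v i"
        using that D by auto
      finally show ?thesis .
    qed
  qed
qed

text \<open>A nonzero minor of maximal size yields a square unimodular subsystem. Expanding the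
  vanishing minors that border it along the new column shows that all other rows of the
  system are fixed combinations of its rows.\<close>

lemma totally_unimodular_integral_solution:
  fixes A :: "'r \<Rightarrow> 'c \<Rightarrow> real"
  assumes tu: "\<And>k r c. inj_on r {..<k} \<Longrightarrow> inj_on c {..<k} \<Longrightarrow>
      sq_det k (\<lambda>i j. A (r i) (c j)) \<in> {-1, 0, 1}"
    and J: "finite J"
    and x: "\<And>i. i \<in> R \<Longrightarrow> (\<Sum>j\<in>J. A i j * x j) = v i"
    and v: "\<And>i. i \<in> R \<Longrightarrow> v i \<in> \<int>"
  obtains z :: "'c \<Rightarrow> int" where "\<And>i. i \<in> R \<Longrightarrow> (\<Sum>j\<in>J. A i j * of_int (z j)) = v i"
proof -
  define minor where "minor = (\<lambda>k. \<exists>r c. inj_on r {..<k} \<and> r ` {..<k} \<subseteq> R \<and>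
    inj_on c {..<k} \<and> c ` {..<k} \<subseteq> J \<and> sq_det k (\<lambda>i j. A (r i) (c j)) \<noteq> 0)"
  \<comment> \<open>The empty determinant is 1. With the bound \<open>card J\<close>, which holds
    because \<open>c\<close> is injective into \<open>J\<close>, a largest nonvanishing size
    exists.\<close>
  have "minor 0"
    by (simp add: minor_def sq_det_def)
  moreover have bound: "k \<le> card J" if "minor k" for k
    using that card_inj_on_le[OF _ _ J, of _ "{..<k}"] by (auto simp: minor_def)
  ultimately obtain k where k: "minor k" and k_max: "\<And>l. minor l \<Longrightarrow> l \<le> k"
    using GreatestI_nat[of minor 0 "card J"] Greatest_le_nat[of minor _ "card J"] by metis
  obtain r c where r: "inj_on r {..<k}" "r ` {..<k} \<subseteq> R" and c: "inj_on c {..<k}" "c ` {..<k} \<subseteq> J"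
    and D: "sq_det k (\<lambda>i j. A (r i) (c j)) \<noteq> 0"
    using k unfolding minor_def by blast
  let ?D = "sq_det k (\<lambda>i j. A (r i) (c j))"
  have A_int: "A i j \<in> \<int>" for i j
    using tu[of "\<lambda>_. i" 1 "\<lambda>_. j"] by (auto simp: inj_on_def sq_det_1)
  obtain y where y: "\<And>j. y j \<in> \<int>"
    and y_eq: "\<And>i. i < k \<Longrightarrow> (\<Sum>j<k. A (r i) (c j) * y j) = v (r i)"
  proof (rule unimodular_system_solvable[of k "\<lambda>i j. A (r i) (c j)" "\<lambda>i. v (r i)"])
    show "?D = 1 \<or> ?D = -1"
      using tu[OF r(1) c(1)] D by auto
  qed (use r A_int v in auto)
  \<comment> \<open>The solution of the square subsystem, extended by 0 to the columns outside the
    minor.\<close>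
  define z where "z = (\<lambda>j. if j \<in> c ` {..<k} then y (the_inv_into {..<k} c j) else 0)"
  have z_sum: "(\<Sum>j\<in>J. A i j * z j) = (\<Sum>b<k. A i (c b) * y b)" for i
  proof -
    have "(\<Sum>j\<in>J. A i j * z j) = (\<Sum>j\<in>c ` {..<k}. A i j * z j)"
      using c J by (intro sum.mono_neutral_right) (auto simp: z_def)
    also have "\<dots> = (\<Sum>b<k. A i (c b) * y b)"
      using c by (simp add: sum.reindex z_def the_inv_into_f_f)
    finally show ?thesis .
  qed
  have dependent: "\<exists>C. \<forall>j\<in>J. A i j * ?D = (\<Sum>a<k. C a * A (r a) j)" if "i \<in> R" for i
  proof -
    \<comment> \<open>\<open>B j\<close> borders the chosen minor with row \<open>i\<close> and
      column \<open>j\<close>. Cofactors along the last column delete the only column involving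
      \<open>j\<close>, so \<open>B undefined\<close> serves for all \<open>j\<close>, and the
      coefficients \<open>C\<close> do not depend on \<open>j\<close>.\<close>
    define B where "B = (\<lambda>j. Matrix.mat (Suc k) (Suc k) (\<lambda>(a, b). A ((r(k := i)) a) ((c(k := j)) b)))"
    define C where "C = (\<lambda>a. - cofactor (B undefined) a k)"
    have "A i j * ?D = (\<Sum>a<k. C a * A (r a) j)" if j: "j \<in> J" for j
    proof -
      let ?M = "\<lambda>a b. A ((r(k := i)) a) ((c(k := j)) b)"
      \<comment> \<open>Either a row or column is repeated, or the bordered matrix is a genuine
        larger minor, which vanishes by maximality of \<open>k\<close>.\<close>
      have "sq_det (Suc k) ?M = 0"
      proof (cases "i \<in> r ` {..<k} \<or> j \<in> c ` {..<k}")
        case True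
        then show ?thesis
        proof
          assume "i \<in> r ` {..<k}"
          then obtain a where "a < k" "i = r a" by auto
          then show ?thesis
            by (intro sq_det_equal_rows[of a _ k]) auto
        next
          assume "j \<in> c ` {..<k}"
          then obtain b where "b < k" "j = c b" by auto
          then show ?thesis
            by (intro sq_det_equal_columns[of b _ k]) auto
        qed
      next
        case False
        have "inj_on (r(k := i)) {..<Suc k}" "inj_on (c(k := j)) {..<Suc k}"
          "(r(k := i)) ` {..<Suc k} \<subseteq> R" "(c(k := j)) ` {..<Suc k} \<subseteq> J"
          using False r c \<open>i \<in> R\<close> j by (auto simp: inj_on_def lessThan_Suc)
        moreover have "\<not> minor (Suc k)"
          using k_max[of "Suc k"] by auto
        ultimately show ?thesis
          unfolding minor_def by blast
      qed
      moreover have "mat_delete (B j) a k = mat_delete (B undefined) a k" for a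
        by (auto simp: B_def mat_delete_def)
      then have "cofactor (B j) a k = - C a" for a
        by (simp add: C_def cofactor_def)
      moreover have "sq_det k ?M = ?D"
        unfolding sq_det_eq_det by (intro arg_cong[where f = Determinant.det]) auto
      ultimately show ?thesis
        using sq_det_last_column[of k ?M] by (simp add: B_def sum_negf mult.commute)
    qed
    then show ?thesis by blast
  qed
  have z_eq: "(\<Sum>j\<in>J. A i j * z j) = v i" if i: "i \<in> R" for i
  proof -
    obtain C where C: "\<And>j. j \<in> J \<Longrightarrow> A i j * ?D = (\<Sum>a<k. C a * A (r a) j)"
      using dependent[OF i] by blast
    have row: "?D * (\<Sum>j\<in>J. A i j * w j) = (\<Sum>a<k. C a * (\<Sum>j\<in>J. A (r a) j * w j))" for w
    proof -
      have "?D * (\<Sum>j\<in>J. A i j * w j) = (\<Sum>j\<in>J. (A i j * ?D) * w j)"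
        by (simp add: sum_distrib_left mult_ac)
      also have "\<dots> = (\<Sum>j\<in>J. \<Sum>a<k. C a * (A (r a) j * w j))"
        by (simp add: C sum_distrib_right mult.assoc)
      also have "\<dots> = (\<Sum>a<k. C a * (\<Sum>j\<in>J. A (r a) j * w j))"
        by (subst sum.swap) (simp add: sum_distrib_left)
      finally show ?thesis .
    qed
    \<comment> \<open>Both \<open>z\<close> and the real solution \<open>x\<close> satisfy the
      chosen rows, so the dependency gives them the same value on row \<open>i\<close>; then
      \<open>?D\<close> cancels.\<close>
    have "?D * (\<Sum>j\<in>J. A i j * z j) = (\<Sum>a<k. C a * v (r a))"
      unfolding row by (intro sum.cong) (auto simp: z_sum y_eq)
    also have "\<dots> = ?D * (\<Sum>j\<in>J. A i j * x j)"
      unfolding row using r x by (intro sum.cong) auto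
    finally show ?thesis
      using D x[OF i] by simp
  qed
  have "z j \<in> \<int>" for j
    using y by (simp add: z_def)
  then have "of_int \<lfloor>z j\<rfloor> = z j" for j
    by simp
  with z_eq show thesis
    by (intro that[of "\<lambda>j. \<lfloor>z j\<rfloor>"]) (simp only:)
qed

subsection \<open>Lattice points as representations\<close>

text \<open>The columns of \<open>[A I]\<close>: \<open>Inl\<close> indexes the original variables,
  \<open>Inr\<close> the slack variables.\<close>

definition augcol :: "real^'n^'m \<Rightarrow> 'n + 'm \<Rightarrow> real^'m" where
  "augcol A = case_sum (\<lambda>j. column j A) (\<lambda>i. axis i 1)"

lemma sum_augcol_nth:
  "(\<Sum>s\<in>T. u s *\<^sub>R augcol A s) $ i =
    (\<Sum>j\<in>Inl -` T. A $ i $ j * u (Inl j)) + (if Inr i \<in> T then u (Inr i) else 0)"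
proof -
  have T: "T = (Inl -` T) <+> (Inr -` T)"
  proof (rule Set.set_eqI)
    fix s show "s \<in> T \<longleftrightarrow> s \<in> (Inl -` T) <+> (Inr -` T)"
      by (cases s) auto
  qed
  have "(\<Sum>s\<in>T. u s *\<^sub>R augcol A s) $ i = (\<Sum>s\<in>(Inl -` T) <+> (Inr -` T). u s * augcol A s $ i)"
    using T by (simp add: sum_component)
  also have "\<dots> = (\<Sum>j\<in>Inl -` T. A $ i $ j * u (Inl j)) + (if Inr i \<in> T then u (Inr i) else 0)"
    by (subst sum.Plus)
      (simp_all add: augcol_def column_def axis_def mult.commute if_distrib[of "(*) _"] cong: if_cong)
  finally show ?thesis .
qed

lemma totally_unimodular_Ints:
  assumes "totally_unimodular A"
  shows "A $ i $ j \<in> \<int>"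
  using assms[unfolded totally_unimodular_def, rule_format, of "\<lambda>_. i" 1 "\<lambda>_. j"]
  by (auto simp: inj_on_def sq_det_1)

text \<open>A row whose slack column lies in \<open>T\<close> can be satisfied last by its own slack
  coefficient, of either sign. The remaining rows form a system in columns of \<open>A\<close>
  alone, to which total unimodularity applies.\<close>

lemma totally_unimodular_augcol_integral:
  fixes A :: "real^'n^'m"
  assumes A: "totally_unimodular A" and b: "\<forall>i. b $ i \<in> \<int>"
    and u: "b = (\<Sum>s\<in>T. u s *\<^sub>R augcol A s)"
  shows "\<exists>z. b = (\<Sum>s\<in>T. of_int (z s) *\<^sub>R augcol A s)"
proof -
  let ?J = "Inl -` T"
  obtain z :: "'n \<Rightarrow> int"
    where z: "\<And>i. i \<in> {i. Inr i \<notin> T} \<Longrightarrow> (\<Sum>j\<in>?J. A $ i $ j * of_int (z j)) = b $ i"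
  proof (rule totally_unimodular_integral_solution[of "\<lambda>i j. A $ i $ j" ?J "{i. Inr i \<notin> T}" "\<lambda>j. u (Inl j)" "\<lambda>i. b $ i"])
    show "(\<Sum>j\<in>?J. A $ i $ j * u (Inl j)) = b $ i" if "i \<in> {i. Inr i \<notin> T}" for i
      using that arg_cong[OF u, of "\<lambda>v. v $ i"] by (simp add: sum_augcol_nth del: sum_component)
  qed (use A b in \<open>auto simp: totally_unimodular_def\<close>)
  \<comment> \<open>Each slack coefficient is the residue of its row. It is already an integer, so
    the floor only changes the type.\<close>
  define w where "w = case_sum z (\<lambda>i. \<lfloor>b $ i - (\<Sum>j\<in>?J. A $ i $ j * of_int (z j))\<rfloor>)"
  have w_Inl: "w (Inl j) = z j" for j
    by (simp add: w_def)
  have w_Inr: "of_int (w (Inr i)) = b $ i - (\<Sum>j\<in>?J. A $ i $ j * of_int (z j))" for i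
  proof -
    have "b $ i - (\<Sum>j\<in>?J. A $ i $ j * of_int (z j)) \<in> \<int>"
      using b by (intro Ints_diff Ints_sum Ints_mult totally_unimodular_Ints[OF A]) auto
    then show ?thesis by (simp add: w_def)
  qed
  have "b = (\<Sum>s\<in>T. of_int (w s) *\<^sub>R augcol A s)"
    using z by (auto simp: Finite_Cartesian_Product.vec_eq_iff sum_augcol_nth w_Inl w_Inr simp del: sum_component)
  then show ?thesis by blast
qed

lemma polyP_nth: "x \<in> polyP A v \<longleftrightarrow> (\<forall>i. (\<Sum>j\<in>UNIV. A $ i $ j * x $ j) \<le> v $ i) \<and> (\<forall>j. 0 \<le> x $ j)"
  by (simp add: polyP_def matrix_vector_mult_def)

lemma finite_bounded_lattice_points:
  fixes S :: "(real^'n) set"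
  assumes "bounded S"
  shows "finite (S \<inter> {x. \<forall>j. x $ j \<in> \<int>})"
proof -
  obtain B where B: "\<And>x. x \<in> S \<Longrightarrow> norm x \<le> B"
    using assms by (auto simp: bounded_iff)
  have "S \<inter> {x. \<forall>j. x $ j \<in> \<int>} \<subseteq> (\<lambda>f. \<chi> j. of_int (f j)) ` (UNIV \<rightarrow>\<^sub>E {-\<lceil>B\<rceil>..\<lceil>B\<rceil>})"
  proof
    fix x assume x: "x \<in> S \<inter> {x. \<forall>j. x $ j \<in> \<int>}"
    have "\<bar>x $ j\<bar> \<le> B" for j
      using B[of x] component_le_norm_cart[of x j] x by auto
    then have "\<lfloor>x $ j\<rfloor> \<in> {-\<lceil>B\<rceil>..\<lceil>B\<rceil>}" for j
      using abs_le_D1[of "x $ j" B] abs_le_D2[of "x $ j" B] by (simp add: le_floor_iff) linarith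
    moreover have "x = (\<chi> j. of_int \<lfloor>x $ j\<rfloor>)"
      using x by (simp add: Finite_Cartesian_Product.vec_eq_iff)
    ultimately show "x \<in> (\<lambda>f. \<chi> j. of_int (f j)) ` (UNIV \<rightarrow>\<^sub>E {-\<lceil>B\<rceil>..\<lceil>B\<rceil>})"
      by (intro image_eqI[of _ _ "\<lambda>j. \<lfloor>x $ j\<rfloor>"]) auto
  qed
  then show ?thesis
    by (rule finite_subset) (intro finite_imageI finite_PiE, auto)
qed

lemma reps_augcol_iff:
  "y \<in> reps (augcol A) UNIV v \<longleftrightarrow>
    (\<forall>i. (\<Sum>j\<in>UNIV. A $ i $ j * real (y (Inl j))) + real (y (Inr i)) = v $ i)"
  by (simp add: reps_def Finite_Cartesian_Product.vec_eq_iff sum_augcol_nth del: sum_component)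

lemma inj_on_reps_augcol: "inj_on (\<lambda>y. \<chi> j. real (y (Inl j))) (reps (augcol A) UNIV v)"
proof (rule inj_onI)
  fix y y'
  assume y: "y \<in> reps (augcol A) UNIV v" "y' \<in> reps (augcol A) UNIV v"
    and eq: "(\<chi> j. real (y (Inl j))) = (\<chi> j. real (y' (Inl j)))"
  then have Inl: "y (Inl j) = y' (Inl j)" for j
    by (simp add: Finite_Cartesian_Product.vec_eq_iff)
  have "real (y (Inr i)) = real (y' (Inr i))" for i
  proof -
    have "(\<Sum>j\<in>UNIV. A $ i $ j * real (y (Inl j))) + real (y (Inr i)) =
        (\<Sum>j\<in>UNIV. A $ i $ j * real (y (Inl j))) + real (y' (Inr i))"
      using y unfolding reps_augcol_iff by (simp add: Inl)
    then show ?thesis by simp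
  qed
  then show "y = y'"
    using Inl by (intro ext) (metis of_nat_eq_iff sum.exhaust)
qed

lemma image_reps_augcol:
  "(\<lambda>y. \<chi> j. real (y (Inl j))) ` reps (augcol A) UNIV v \<subseteq> polyP A v \<inter> {x. \<forall>j. x $ j \<in> \<int>}"
proof (rule image_subsetI)
  fix y assume "y \<in> reps (augcol A) UNIV v"
  then have eq: "(\<Sum>j\<in>UNIV. A $ i $ j * real (y (Inl j))) + real (y (Inr i)) = v $ i" for i
    by (simp add: reps_augcol_iff)
  have "(\<Sum>j\<in>UNIV. A $ i $ j * real (y (Inl j))) \<le> v $ i" for i
    using eq[of i] of_nat_0_le_iff[of "y (Inr i)", where 'a = real] by linarith
  then show "(\<chi> j. real (y (Inl j))) \<in> polyP A v \<inter> {x. \<forall>j. x $ j \<in> \<int>}"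
    by (simp add: polyP_nth)
qed

lemma finite_reps_augcol: "bounded (polyP A v) \<Longrightarrow> finite (reps (augcol A) UNIV v)"
  using inj_on_finite[OF inj_on_reps_augcol image_reps_augcol] finite_bounded_lattice_points by blast

text \<open>Forgetting the slack coordinates is a bijection: they are determined by
  \<open>x\<close>, and they are natural numbers because \<open>A\<close>, \<open>v\<close> and
  \<open>x\<close> are integral and \<open>x\<close> is feasible.\<close>

lemma latN_eq_card_reps:
  assumes A: "\<And>i j. A $ i $ j \<in> \<int>" and v: "\<And>i. v $ i \<in> \<int>"
  shows "latN A v = card (reps (augcol A) UNIV v)"
proof -
  have "polyP A v \<inter> {x. \<forall>j. x $ j \<in> \<int>} \<subseteq> (\<lambda>y. \<chi> j. real (y (Inl j))) ` reps (augcol A) UNIV v"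
  proof
    fix x assume x: "x \<in> polyP A v \<inter> {x. \<forall>j. x $ j \<in> \<int>}"
    define y where "y = case_sum (\<lambda>j. nat \<lfloor>x $ j\<rfloor>)
      (\<lambda>i. nat \<lfloor>v $ i - (\<Sum>j\<in>UNIV. A $ i $ j * x $ j)\<rfloor>)"
    have Inl: "real (y (Inl j)) = x $ j" for j
      using x by (simp add: y_def polyP_nth)
    have "v $ i - (\<Sum>j\<in>UNIV. A $ i $ j * x $ j) \<in> \<int>" for i
      using x by (intro Ints_diff Ints_sum Ints_mult A v) auto
    then have "real (y (Inr i)) = v $ i - (\<Sum>j\<in>UNIV. A $ i $ j * x $ j)" for i
      using x by (simp add: y_def polyP_nth)
    then have "y \<in> reps (augcol A) UNIV v"
      by (simp add: reps_augcol_iff Inl)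
    moreover have "x = (\<chi> j. real (y (Inl j)))"
      by (simp add: Finite_Cartesian_Product.vec_eq_iff Inl)
    ultimately show "x \<in> (\<lambda>y. \<chi> j. real (y (Inl j))) ` reps (augcol A) UNIV v"
      by blast
  qed
  with image_reps_augcol[of A v] have "polyP A v \<inter> {x. \<forall>j. x $ j \<in> \<int>} =
      (\<lambda>y. \<chi> j. real (y (Inl j))) ` reps (augcol A) UNIV v"
    by blast
  then show ?thesis
    by (simp add: latN_def card_image inj_on_reps_augcol)
qed

subsection \<open>Polyhedra with varying right-hand side\<close>

lemma polyP_inner: "x \<in> polyP A v \<longleftrightarrow> (\<forall>i. inner (A $ i) x \<le> v $ i) \<and> (\<forall>j. 0 \<le> x $ j)"
  by (simp add: polyP_nth inner_vec_def)

lemma polyP_eq_Inter_halfspaces: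
  "polyP A v = (\<Inter>i. {x. inner (A $ i) x \<le> v $ i}) \<inter> (\<Inter>j. {x. inner (axis j 1) x \<ge> 0})"
  by (auto simp: polyP_inner inner_axis')

lemma closed_polyP: "closed (polyP A v)"
  unfolding polyP_eq_Inter_halfspaces
  by (intro closed_Int closed_INT ballI closed_halfspace_le closed_halfspace_ge)

lemma convex_polyP: "convex (polyP A v)"
  unfolding polyP_eq_Inter_halfspaces
  by (intro convex_Int convex_INT convex_halfspace_le convex_halfspace_ge)

lemma polyP_mono: "(\<And>i. v $ i \<le> w $ i) \<Longrightarrow> polyP A v \<subseteq> polyP A w"
  unfolding polyP_inner subset_iff by (meson order_trans)

lemma scaleR_in_polyP_iff:
  assumes "0 < k"
  shows "k *\<^sub>R x \<in> polyP A (k *\<^sub>R v) \<longleftrightarrow> x \<in> polyP A v"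
  using assms by (simp add: polyP_inner zero_le_mult_iff)

lemma polyP_scaleR:
  assumes "0 < k"
  shows "polyP A (k *\<^sub>R v) = (\<lambda>x. k *\<^sub>R x) ` polyP A v"
proof -
  have "x \<in> (\<lambda>x. k *\<^sub>R x) ` polyP A v" if "x \<in> polyP A (k *\<^sub>R v)" for x
    using that assms scaleR_in_polyP_iff[OF assms, of "(1 / k) *\<^sub>R x" A v]
    by (intro image_eqI[of _ _ "(1 / k) *\<^sub>R x"]) auto
  then show ?thesis
    using scaleR_in_polyP_iff[OF assms] by blast
qed

text \<open>A nonempty bounded polyhedron has trivial recession cone, and the recession cone does not
  depend on the right-hand side.\<close>

lemma polyP_norm_le:
  fixes A :: "real^'n^'m"
  assumes bdd: "bounded (polyP A b)" and ne: "polyP A b \<noteq> {}"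
  obtains C where "\<And>v x. x \<in> polyP A v \<Longrightarrow> norm x \<le> C * norm v"
proof -
  \<comment> \<open>\<open>f\<close> measures the violation of \<open>A x \<le> 0\<close>. On
    \<open>K\<close>, the nonnegative part of the unit sphere, a zero of \<open>f\<close> would be a
    recession direction; excluding it gives \<open>f\<close> a positive minimum on the compact set
    \<open>K\<close>.\<close>
  define f where "f = (\<lambda>x. \<Sum>i\<in>UNIV. max 0 (inner (A $ i) x))"
  define K where "K = sphere (0 :: real^'n) 1 \<inter> (\<Inter>j. {x. inner (axis j 1) x \<ge> 0})"
  have K: "x \<in> K \<longleftrightarrow> norm x = 1 \<and> (\<forall>j. 0 \<le> x $ j)" for x
    by (auto simp: K_def inner_axis')
  have "compact K"
    unfolding K_def by (intro compact_Int_closed compact_sphere closed_INT ballI closed_halfspace_ge)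
  moreover have "axis undefined 1 \<in> K"
    unfolding K by (simp add: norm_axis_1) (simp add: axis_def)
  moreover have "continuous_on K f"
    unfolding f_def by (intro continuous_intros)
  ultimately obtain x0 where x0: "x0 \<in> K" and min: "\<And>x. x \<in> K \<Longrightarrow> f x0 \<le> f x"
    using continuous_attains_inf[of K f] by blast
  have f_nonneg: "0 \<le> f x" for x
    by (simp add: f_def sum_nonneg)
  have "f x0 \<noteq> 0"
  proof
    assume "f x0 = 0"
    then have "max 0 (inner (A $ i) x0) = 0" for i
      unfolding f_def by (subst (asm) sum_nonneg_eq_0_iff) auto
    then have dir: "inner (A $ i) x0 \<le> 0" for i
      by (metis max.cobounded2)
    obtain y where y: "y \<in> polyP A b" using ne by blast
    obtain B where B: "\<And>x. x \<in> polyP A b \<Longrightarrow> norm x \<le> B"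
      using bdd by (auto simp: bounded_iff)
    \<comment> \<open>Large enough for \<open>y + t *\<^sub>R x0\<close> to leave the ball of radius
      \<open>B\<close>.\<close>
    define t where "t = B + norm y + 1"
    have "t > 0" using B[OF y] norm_ge_zero[of y] unfolding t_def by linarith
    have "y + t *\<^sub>R x0 \<in> polyP A b"
      unfolding polyP_inner
    proof (intro conjI allI)
      fix i
      have "t * inner (A $ i) x0 \<le> 0"
        using dir[of i] \<open>t > 0\<close> by (simp add: mult_le_0_iff)
      then show "inner (A $ i) (y + t *\<^sub>R x0) \<le> b $ i"
        using y[unfolded polyP_inner] by (simp add: inner_add_right) (smt (verit))
    next
      fix j show "0 \<le> (y + t *\<^sub>R x0) $ j"
        using y[unfolded polyP_inner] x0 K \<open>t > 0\<close> by simp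
    qed
    then have "norm (y + t *\<^sub>R x0) \<le> B" by (rule B)
    moreover have "norm (t *\<^sub>R x0) \<le> norm (y + t *\<^sub>R x0) + norm y"
      by (metis add.commute add_diff_cancel_left' norm_triangle_ineq4)
    ultimately show False
      using x0 \<open>t > 0\<close> by (simp add: K t_def)
  qed
  then have pos: "f x0 > 0" using f_nonneg[of x0] by simp
  show thesis
  proof (rule that[of "real CARD('m) / f x0"])
    fix v :: "real^'m" and x assume x: "x \<in> polyP A v"
    \<comment> \<open>\<open>f\<close> is positively homogeneous, so its minimum on \<open>K\<close>
      bounds \<open>f x\<close> from below; feasibility bounds each summand of \<open>f x\<close> by
      \<open>norm v\<close>.\<close>
    have "norm x * f x0 \<le> real CARD('m) * norm v"
    proof (cases "x = 0")
      case False
      have "(1 / norm x) *\<^sub>R x \<in> K"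
        using x False by (simp add: K polyP_inner)
      then have "f x0 \<le> f ((1 / norm x) *\<^sub>R x)" by (rule min)
      also have "\<dots> = (1 / norm x) * f x"
        using False by (simp add: f_def sum_divide_distrib max_divide_distrib_right)
      finally have "norm x * f x0 \<le> f x"
        using False by (simp add: field_simps)
      also have "f x \<le> (\<Sum>i\<in>(UNIV :: 'm set). norm v)"
        unfolding f_def
      proof (rule sum_mono)
        fix i
        have "inner (A $ i) x \<le> v $ i" using x by (simp add: polyP_inner)
        then show "max 0 (inner (A $ i) x) \<le> norm v"
          using component_le_norm_cart[of v i] by linarith
      qed
      finally show ?thesis by simp
    qed auto
    then show "norm x \<le> real CARD('m) / f x0 * norm v"
      using pos by (simp add: field_simps)
  qed
qed

section \<open>The cone of feasible right-hand sides\<close>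

text \<open>With slacks, feasibility of \<open>v\<close> means that \<open>v\<close> is a
  nonnegative combination of the columns of \<open>[A I]\<close>. As a finitely generated cone, the
  set of feasible \<open>v\<close> is closed.\<close>

lemma convex_cone_hull_augcol:
  "convex_cone hull (range (augcol A)) = {v. polyP A v \<noteq> {}}" (is "?H = ?S")
proof
  show "?H \<subseteq> ?S"
  proof (rule hull_minimal)
    show "range (augcol A) \<subseteq> ?S"
    proof (rule image_subsetI)
      fix s
      show "augcol A s \<in> ?S"
      proof (cases s)
        case (Inl j)
        then have "axis j 1 \<in> polyP A (augcol A s)"
          by (simp add: polyP_inner augcol_def column_def inner_axis) (simp add: axis_def)
        then show ?thesis by blast
      next
        case (Inr i)
        then have "0 \<in> polyP A (augcol A s)"
          by (simp add: polyP_inner augcol_def) (simp add: axis_def)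
        then show ?thesis by blast
      qed
    qed
    have "x + y \<in> polyP A (v + w)" if "x \<in> polyP A v" "y \<in> polyP A w" for x y v w
      using that by (simp add: polyP_inner inner_add_right add_mono)
    moreover have "0 \<in> polyP A 0"
      by (simp add: polyP_inner)
    moreover have "k *\<^sub>R x \<in> polyP A (k *\<^sub>R v)" if "x \<in> polyP A v" "k \<ge> 0" for x v k
      using that by (simp add: polyP_inner mult_left_mono)
    ultimately show "convex_cone ?S"
      unfolding convex_cone_iff by blast
  qed
next
  show "?S \<subseteq> ?H"
  proof
    fix v assume "v \<in> ?S"
    then obtain x where x: "x \<in> polyP A v" by blast
    define u where "u = case_sum (\<lambda>j. x $ j) (\<lambda>i. v $ i - inner (A $ i) x)"
    have u: "u s \<ge> 0" for s
      using x by (cases s) (auto simp: u_def polyP_inner)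
    have gen: "augcol A s \<in> ?H" for s
      by (simp add: hull_inc)
    have "(\<Sum>s\<in>T. u s *\<^sub>R augcol A s) \<in> ?H" if "finite T" for T
      using that
      by (induction T rule: finite_induct)
        (auto intro!: convex_cone_hull_add convex_cone_hull_mul convex_cone_hull_contains_0 gen u)
    then have "(\<Sum>s\<in>UNIV. u s *\<^sub>R augcol A s) \<in> ?H" by simp
    moreover have "(\<Sum>s\<in>UNIV. u s *\<^sub>R augcol A s) = v"
      by (simp add: Finite_Cartesian_Product.vec_eq_iff sum_augcol_nth u_def inner_vec_def
          del: sum_component)
    ultimately show "v \<in> ?H" by simp
  qed
qed

text \<open>Infeasibility is an open condition, so it passes from \<open>b\<close> to
  \<open>b + c / k\<close> for large \<open>k\<close>; scaling by \<open>k\<close> preserves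
  it.\<close>

lemma eventually_polyP_empty:
  fixes A :: "real^'n^'m"
  assumes "polyP A b = {}"
  shows "\<forall>\<^sub>F k in sequentially. polyP A (real k *\<^sub>R b + c) = {}"
proof -
  let ?U = "- {v. polyP A v \<noteq> {}}"
  have "finite (range (augcol A))" by simp
  then have "open ?U"
    unfolding convex_cone_hull_augcol[symmetric] by (intro open_Compl closed_convex_cone_hull)
  have "(\<lambda>k. b + (1 / real k) *\<^sub>R c) \<longlonglongrightarrow> b + 0 *\<^sub>R c"
    by (intro tendsto_intros lim_1_over_n)
  then have "\<forall>\<^sub>F k in sequentially. b + (1 / real k) *\<^sub>R c \<in> ?U"
    using \<open>open ?U\<close> assms by (intro topological_tendstoD[of _ b]) auto
  then show ?thesis
    using eventually_gt_at_top[of 0]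
  proof eventually_elim
    case (elim k)
    have "real k *\<^sub>R b + c = real k *\<^sub>R (b + (1 / real k) *\<^sub>R c)"
      using elim by (simp add: scaleR_add_right)
    with elim show ?case
      by (simp only: polyP_scaleR of_nat_0_less_iff) auto
  qed
qed

subsection \<open>Lattice points and volume\<close>

text \<open>Bounds the change of a constraint value within a unit cube. Summing over all rows makes
  the bound uniform in \<open>i\<close>.\<close>

lemma abs_inner_row_le:
  fixes A :: "real^'n^'m"
  assumes "\<And>j. \<bar>z $ j\<bar> \<le> 1"
  shows "\<bar>inner (A $ i) z\<bar> \<le> (\<Sum>i\<in>UNIV. \<Sum>j\<in>UNIV. \<bar>A $ i $ j\<bar>)"
proof -
  have "\<bar>inner (A $ i) z\<bar> \<le> (\<Sum>j\<in>UNIV. \<bar>A $ i $ j\<bar> * \<bar>z $ j\<bar>)"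
    unfolding inner_vec_def by (rule order_trans[OF sum_abs]) (simp add: abs_mult)
  also have "\<dots> \<le> (\<Sum>j\<in>UNIV. \<bar>A $ i $ j\<bar>)"
    using assms by (intro sum_mono mult_left_le) auto
  also have "\<dots> \<le> (\<Sum>i\<in>UNIV. \<Sum>j\<in>UNIV. \<bar>A $ i $ j\<bar>)"
    by (rule member_le_sum) (auto intro: sum_nonneg)
  finally show ?thesis .
qed

lemma measure_unit_box:
  fixes x :: "real^'n"
  shows "measure lebesgue (box x (x + (\<chi> j. 1))) = 1" "measure lebesgue (cbox x (x + (\<chi> j. 1))) = 1"
proof -
  have "cbox x (x + (\<chi> j. 1)) \<noteq> {}"
    by (simp add: interval_ne_empty_cart)
  then show cbox: "measure lebesgue (cbox x (x + (\<chi> j. 1))) = 1"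
    by (simp add: content_cbox_cart)
  have "measure lborel (box x (x + (\<chi> j. 1))) = measure lborel (cbox x (x + (\<chi> j. 1)))"
    by (simp only: measure_lborel_box_eq measure_lborel_cbox_eq)
  with cbox show "measure lebesgue (box x (x + (\<chi> j. 1))) = 1"
    by simp
qed

lemma lmeasurable_polyP: "bounded (polyP A v) \<Longrightarrow> polyP A v \<in> lmeasurable"
  by (simp add: lmeasurable_compact compact_eq_bounded_closed closed_polyP)

lemma measure_polyP_mono:
  assumes "\<And>i. v $ i \<le> w $ i" "bounded (polyP A v)" "bounded (polyP A w)"
  shows "measure lebesgue (polyP A v) \<le> measure lebesgue (polyP A w)"
  by (intro measure_mono_fmeasurable polyP_mono lmeasurable_polyP fmeasurableD assms)

text \<open>Both volume bounds compare the polyhedron with the union of the unit cubes whose lower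
  corners are its lattice points.\<close>

lemma latN_le_measure:
  fixes A :: "real^'n^'m"
  defines "L \<equiv> \<Sum>i\<in>UNIV. \<Sum>j\<in>UNIV. \<bar>A $ i $ j\<bar>"
  assumes bdd: "bounded (polyP A v)" "bounded (polyP A (v + (\<chi> i. L)))"
  shows "real (latN A v) \<le> measure lebesgue (polyP A (v + (\<chi> i. L)))"
proof -
  define F where "F = polyP A v \<inter> {x. \<forall>j. x $ j \<in> \<int>}"
  \<comment> \<open>Open cubes, so that distinct lattice points have disjoint cubes: rounding down
    any point of a cube recovers its corner.\<close>
  let ?Q = "\<lambda>x :: real^'n. box x (x + (\<chi> j. 1))"
  have fin: "finite F"
    unfolding F_def by (rule finite_bounded_lattice_points[OF bdd(1)])
  have "disjoint_family_on ?Q F"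
    unfolding disjoint_family_on_def
  proof (intro ballI impI)
    fix x x' assume x: "x \<in> F" "x' \<in> F" "x \<noteq> x'"
    have "x = x'" if "y \<in> ?Q x" "y \<in> ?Q x'" for y
    proof -
      have "x $ j = of_int \<lfloor>y $ j\<rfloor>" if "x \<in> F" "y \<in> ?Q x" for x j
      proof -
        have "x $ j \<in> \<int>"
          using that by (simp add: F_def)
        then obtain a where "x $ j = of_int a"
          by (rule Ints_cases)
        moreover have "x $ j < y $ j" "y $ j < x $ j + 1"
          using that(2) by (auto simp: mem_box_cart)
        ultimately have "\<lfloor>y $ j\<rfloor> = a"
          by linarith
        with \<open>x $ j = of_int a\<close> show ?thesis by simp
      qed
      then show ?thesis
        using x that by (simp add: Finite_Cartesian_Product.vec_eq_iff)
    qed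
    with x(3) show "?Q x \<inter> ?Q x' = {}" by blast
  qed
  then have "measure lebesgue (\<Union>x\<in>F. ?Q x) = (\<Sum>x\<in>F. measure lebesgue (?Q x))"
    using fin by (intro measure_finite_Union) (auto simp: emeasure_lborel_box_eq)
  also have "\<dots> = real (latN A v)"
    by (simp only: measure_unit_box latN_def F_def) simp
  finally have "real (latN A v) = measure lebesgue (\<Union>x\<in>F. ?Q x)" ..
  also have "\<dots> \<le> measure lebesgue (polyP A (v + (\<chi> i. L)))"
  proof (rule measure_mono_fmeasurable)
    show "(\<Union>x\<in>F. ?Q x) \<subseteq> polyP A (v + (\<chi> i. L))"
    proof (rule UN_least, rule subsetI)
      fix x y assume x: "x \<in> F" and y: "y \<in> ?Q x"
      have d: "\<bar>(y - x) $ j\<bar> \<le> 1" for j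
        using y by (simp add: mem_box_cart abs_le_iff) (smt (verit))
      have "inner (A $ i) (y - x) \<le> L" for i
        using abs_inner_row_le[of "y - x" A i, OF d] unfolding L_def by linarith
      then have "inner (A $ i) y \<le> v $ i + L" for i
        using x by (simp add: F_def polyP_inner inner_diff_right) (smt (verit))
      moreover have "0 \<le> y $ j" for j
        using x y by (simp add: F_def polyP_inner mem_box_cart) (smt (verit))
      ultimately show "y \<in> polyP A (v + (\<chi> i. L))"
        by (simp add: polyP_inner)
    qed
  qed (use fin lmeasurable_polyP[OF bdd(2)] in auto)
  finally show ?thesis .
qed

lemma measure_le_latN:
  fixes A :: "real^'n^'m"
  defines "L \<equiv> \<Sum>i\<in>UNIV. \<Sum>j\<in>UNIV. \<bar>A $ i $ j\<bar>"
  assumes bdd: "bounded (polyP A v)"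
  shows "measure lebesgue (polyP A (v - (\<chi> i. L))) \<le> real (latN A v)"
proof -
  define F where "F = polyP A v \<inter> {x. \<forall>j. x $ j \<in> \<int>}"
  \<comment> \<open>Closed cubes, so that they cover. Overlaps are harmless here, since only
    subadditivity of the measure is used.\<close>
  let ?Q = "\<lambda>x :: real^'n. cbox x (x + (\<chi> j. 1))"
  have fin: "finite F"
    unfolding F_def by (rule finite_bounded_lattice_points[OF bdd])
  have "measure lebesgue (polyP A (v - (\<chi> i. L))) \<le> measure lebesgue (\<Union>x\<in>F. ?Q x)"
  proof (rule measure_mono_fmeasurable)
    show "polyP A (v - (\<chi> i. L)) \<subseteq> (\<Union>x\<in>F. ?Q x)"
    proof
      fix y assume y: "y \<in> polyP A (v - (\<chi> i. L))"
      \<comment> \<open>Rounding down keeps the coordinates nonnegative, and the margin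
        \<open>L\<close> absorbs the change in each constraint.\<close>
      define x :: "real^'n" where "x = (\<chi> j. of_int \<lfloor>y $ j\<rfloor>)"
      have x_nth: "x $ j = of_int \<lfloor>y $ j\<rfloor>" for j by (simp add: x_def)
      have d: "\<bar>(x - y) $ j\<bar> \<le> 1" for j
        unfolding vector_minus_component x_nth by linarith
      have "inner (A $ i) (x - y) \<le> L" for i
        using abs_inner_row_le[of "x - y" A i, OF d] unfolding L_def by linarith
      then have "inner (A $ i) x \<le> v $ i" for i
        using y by (simp add: polyP_inner inner_diff_right) (smt (verit))
      moreover have "0 \<le> x $ j" for j
        using y by (simp add: x_nth polyP_inner)
      ultimately have "x \<in> F"
        by (simp add: F_def polyP_inner x_nth)
      moreover have "y \<in> ?Q x"
        by (simp add: mem_box_cart x_nth)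
      ultimately show "y \<in> (\<Union>x\<in>F. ?Q x)" by blast
    qed
    show "(\<Union>x\<in>F. ?Q x) \<in> lmeasurable"
      using fin by (intro fmeasurable.finite_UN) auto
  qed (simp add: closed_polyP)
  also have "\<dots> \<le> (\<Sum>x\<in>F. measure lebesgue (?Q x))"
    using fin by (intro measure_UNION_le) auto
  also have "\<dots> = real (latN A v)"
    by (simp only: measure_unit_box latN_def F_def) simp
  finally show ?thesis .
qed

lemma measure_polyP_scaleR:
  fixes A :: "real^'n^'m"
  assumes "0 < k"
  shows "measure lebesgue (polyP A (k *\<^sub>R v)) = k ^ CARD('n) * measure lebesgue (polyP A v)"
  using measure_lebesgue_affine[of k 0 "polyP A v"] assms by (simp add: polyP_scaleR)

text \<open>The offset \<open>c\<close> and the cube error move each right-hand side by at most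
  \<open>C\<close>, which becomes \<open>C / k\<close> once the factor \<open>k\<close> is taken
  out.\<close>

lemma latN_dilation_bounds:
  fixes A :: "real^'n^'m" and c :: "real^'m"
  assumes bdd: "\<And>v. bounded (polyP A v)" and k: "0 < k"
  defines "C \<equiv> (\<Sum>i\<in>UNIV. \<Sum>j\<in>UNIV. \<bar>A $ i $ j\<bar>) + norm c"
  shows "real (latN A (k *\<^sub>R b + c)) \<le> k ^ CARD('n) * measure lebesgue (polyP A (b + (\<chi> i. C / k)))"
    and "k ^ CARD('n) * measure lebesgue (polyP A (b - (\<chi> i. C / k))) \<le> real (latN A (k *\<^sub>R b + c))"
proof -
  define L where "L = (\<Sum>i\<in>UNIV. \<Sum>j\<in>UNIV. \<bar>A $ i $ j\<bar>)"
  have C: "C = L + norm c"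
    by (simp add: C_def L_def)
  have c: "\<bar>c $ i\<bar> \<le> norm c" for i
    by (rule component_le_norm_cart)
  have "real (latN A (k *\<^sub>R b + c)) \<le> measure lebesgue (polyP A (k *\<^sub>R b + c + (\<chi> i. L)))"
    unfolding L_def by (intro latN_le_measure bdd)
  also have "\<dots> \<le> measure lebesgue (polyP A (k *\<^sub>R (b + (\<chi> i. C / k))))"
  proof (intro measure_polyP_mono bdd)
    show "(k *\<^sub>R b + c + (\<chi> i. L)) $ i \<le> (k *\<^sub>R (b + (\<chi> i. C / k))) $ i" for i
      using k by (simp add: distrib_left) (use c[of i] C in linarith)
  qed
  finally show "real (latN A (k *\<^sub>R b + c)) \<le> k ^ CARD('n) * measure lebesgue (polyP A (b + (\<chi> i. C / k)))"
    using k by (simp add: measure_polyP_scaleR)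
  have "k ^ CARD('n) * measure lebesgue (polyP A (b - (\<chi> i. C / k))) =
      measure lebesgue (polyP A (k *\<^sub>R (b - (\<chi> i. C / k))))"
    using k by (simp add: measure_polyP_scaleR)
  also have "\<dots> \<le> measure lebesgue (polyP A (k *\<^sub>R b + c - (\<chi> i. L)))"
  proof (intro measure_polyP_mono bdd)
    show "(k *\<^sub>R (b - (\<chi> i. C / k))) $ i \<le> (k *\<^sub>R b + c - (\<chi> i. L)) $ i" for i
      using k by (simp add: right_diff_distrib) (use c[of i] C in linarith)
  qed
  also have "\<dots> \<le> real (latN A (k *\<^sub>R b + c))"
    unfolding L_def by (intro measure_le_latN bdd)
  finally show "k ^ CARD('n) * measure lebesgue (polyP A (b - (\<chi> i. C / k))) \<le> real (latN A (k *\<^sub>R b + c))" .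
qed

section \<open>Continuity of the volume in the right-hand side\<close>

text \<open>Continuity from above: the enlarged copies decrease to \<open>polyP A b\<close>.
  Indexing by \<open>Suc k\<close> avoids the value \<open>C / 0 = 0\<close>, which could break
  monotonicity.\<close>

lemma measure_polyP_upper_limit:
  fixes A :: "real^'n^'m"
  assumes bdd: "\<And>v. bounded (polyP A v)" and C: "C \<ge> 0"
  shows "(\<lambda>k. measure lebesgue (polyP A (b + (\<chi> i. C / real (Suc k))))) \<longlonglongrightarrow> measure lebesgue (polyP A b)"
proof -
  let ?P = "\<lambda>k. polyP A (b + (\<chi> i. C / real (Suc k)))"
  have "(\<lambda>k. measure lebesgue (?P k)) \<longlonglongrightarrow> measure lebesgue (\<Inter>k. ?P k)"
  proof (rule Lim_measure_decseq)
    show "decseq ?P"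
      unfolding decseq_Suc_iff using C by (auto intro!: polyP_mono divide_left_mono)
    show "emeasure lebesgue (?P k) \<noteq> \<infinity>" for k
      unfolding infinity_ennreal_def by (rule fmeasurableD2[OF lmeasurable_polyP[OF bdd]])
  qed (auto simp: closed_polyP)
  also have "(\<Inter>k. ?P k) = polyP A b"
  proof
    show "polyP A b \<subseteq> (\<Inter>k. ?P k)"
      using C by (intro INT_greatest polyP_mono) simp
    show "(\<Inter>k. ?P k) \<subseteq> polyP A b"
    proof
      fix x assume x: "x \<in> (\<Inter>k. ?P k)"
      have "inner (A $ i) x \<le> b $ i" for i
      proof (rule LIMSEQ_le_const)
        show "(\<lambda>k. b $ i + C / real (Suc k)) \<longlonglongrightarrow> b $ i"
          using tendsto_add[OF tendsto_const LIMSEQ_Suc[OF lim_const_over_n[of C]]] by simp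
        show "\<exists>N. \<forall>k\<ge>N. inner (A $ i) x \<le> b $ i + C / real (Suc k)"
          using x by (auto simp: polyP_inner)
      qed
      then show "x \<in> polyP A b"
        using x by (simp add: polyP_inner)
    qed
  qed
  finally show ?thesis .
qed

text \<open>The shrunk copies increase to a set that misses only points of \<open>polyP A b\<close>
  on the hyperplanes \<open>inner (A $ i) x = b $ i\<close>. These are null sets because no row
  vanishes.\<close>

lemma measure_polyP_lower_limit:
  fixes A :: "real^'n^'m"
  assumes bdd: "\<And>v. bounded (polyP A v)" and C: "C \<ge> 0" and rows: "\<And>i. A $ i \<noteq> 0"
  shows "(\<lambda>k. measure lebesgue (polyP A (b - (\<chi> i. C / real (Suc k))))) \<longlonglongrightarrow> measure lebesgue (polyP A b)"
proof -
  let ?P = "\<lambda>k. polyP A (b - (\<chi> i. C / real (Suc k)))"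
  have sub: "(\<Union>k. ?P k) \<subseteq> polyP A b"
    using C by (intro UN_least polyP_mono) simp
  have meas: "(\<Union>k. ?P k) \<in> lmeasurable"
    by (rule fmeasurableI2[OF lmeasurable_polyP[OF bdd] sub]) (auto simp: closed_polyP)
  have "(\<lambda>k. measure lebesgue (?P k)) \<longlonglongrightarrow> measure lebesgue (\<Union>k. ?P k)"
  proof (rule Lim_measure_incseq)
    show "incseq ?P"
      unfolding incseq_Suc_iff using C by (auto intro!: polyP_mono divide_left_mono)
    show "emeasure lebesgue (\<Union>k. ?P k) \<noteq> \<infinity>"
      unfolding infinity_ennreal_def by (rule fmeasurableD2[OF meas])
  qed (auto simp: closed_polyP)
  also have "measure lebesgue (\<Union>k. ?P k) = measure lebesgue (polyP A b)"
  proof (rule measure_negligible_symdiff[symmetric])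
    have "polyP A b - (\<Union>k. ?P k) \<subseteq> (\<Union>i. {x. inner (A $ i) x = b $ i})"
    proof
      fix x assume x: "x \<in> polyP A b - (\<Union>k. ?P k)"
      show "x \<in> (\<Union>i. {x. inner (A $ i) x = b $ i})"
      proof (rule ccontr)
        assume "x \<notin> (\<Union>i. {x. inner (A $ i) x = b $ i})"
        then have less: "inner (A $ i) x < b $ i" for i
          using x by (auto simp: polyP_inner less_le)
        have "\<forall>\<^sub>F k in sequentially. inner (A $ i) x < b $ i - C / real (Suc k)" for i
        proof (rule order_tendstoD(1)[OF _ less])
          show "(\<lambda>k. b $ i - C / real (Suc k)) \<longlonglongrightarrow> b $ i"
            using tendsto_diff[OF tendsto_const LIMSEQ_Suc[OF lim_const_over_n[of C]]] by simp
        qed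
        \<comment> \<open>There are finitely many rows, so one \<open>k\<close> serves them
          all.\<close>
        then have "\<forall>\<^sub>F k in sequentially. \<forall>i. inner (A $ i) x < b $ i - C / real (Suc k)"
          by (rule eventually_all_finite)
        then obtain k where "\<forall>i. inner (A $ i) x < b $ i - C / real (Suc k)"
          by (auto simp: eventually_sequentially)
        then have "x \<in> ?P k"
          using x by (simp add: polyP_inner less_imp_le)
        with x show False by blast
      qed
    qed
    moreover have "negligible (\<Union>i. {x. inner (A $ i) x = b $ i})"
      using rows by (intro negligible_Union) (auto intro!: negligible_hyperplane)
    ultimately have "negligible (polyP A b - (\<Union>k. ?P k))"
      by (rule negligible_subset[rotated])
    then show "negligible (sym_diff (\<Union>k. ?P k) (polyP A b))"
      using sub by (simp add: Diff_eq_empty_iff[THEN iffD2])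
  qed (rule meas)
  finally show ?thesis .
qed

text \<open>A convex set whose affine hull is the whole space has interior points, hence is not
  negligible.\<close>

lemma measure_polyP_pos:
  fixes A :: "real^'n^'m"
  assumes bdd: "bounded (polyP A b)" and dim: "aff_dim (polyP A b) = int CARD('n)"
  shows "0 < measure lebesgue (polyP A b)"
proof -
  have "affine hull (polyP A b) = UNIV"
    using dim aff_dim_eq_full[of "polyP A b"] by simp
  moreover have "polyP A b \<noteq> {}"
    using dim by auto
  ultimately have "interior (polyP A b) \<noteq> {}"
    using rel_interior_eq_empty[OF convex_polyP] rel_interior_interior by metis
  then have "\<not> negligible (polyP A b)"
    by (simp add: negligible_convex_interior convex_polyP)
  then show ?thesis
    using lmeasurable_polyP[OF bdd] by (simp add: negligible_iff_measure zero_less_measure_iff)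
qed

section \<open>Degree and leading coefficient from growth\<close>

lemma poly_over_lead_power_tendsto:
  fixes p :: "real poly"
  shows "(\<lambda>k. poly p (real k) / real k ^ degree p) \<longlonglongrightarrow> lead_coeff p"
  by (rule filterlim_compose[OF poly_divide_tendsto_aux filterlim_real_at_infinity_sequentially])

lemma poly_over_power_tendsto:
  fixes p :: "real poly"
  assumes "degree p \<le> n"
  shows "(\<lambda>k. poly p (real k) / real k ^ n) \<longlonglongrightarrow> coeff p n"
proof -
  have "(\<lambda>k. poly p (real k) / real k ^ degree p * (1 / real k) ^ (n - degree p))
      \<longlonglongrightarrow> lead_coeff p * 0 ^ (n - degree p)"
    by (intro tendsto_intros poly_over_lead_power_tendsto lim_1_over_n)
  \<comment> \<open>The power of 0 is 1 exactly when \<open>n = degree p\<close>; otherwise both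
    sides are 0.\<close>
  moreover have "lead_coeff p * 0 ^ (n - degree p) = coeff p n"
    using assms by (cases "n = degree p") (auto simp: coeff_eq_0)
  moreover have "poly p (real k) / real k ^ degree p * (1 / real k) ^ (n - degree p) =
      poly p (real k) / real k ^ n" for k
    using assms by (simp add: power_one_over flip: power_add)
  ultimately show ?thesis by simp
qed

text \<open>If the degree exceeded \<open>n\<close>, dividing by \<open>real k ^ degree p\<close>
  would give the limit 0, although the limit is the nonzero leading coefficient.\<close>

lemma degree_le_of_growth:
  fixes p :: "real poly"
  assumes "\<forall>\<^sub>F k in sequentially. \<bar>poly p (real k)\<bar> \<le> real k ^ n * V"
  shows "degree p \<le> n"
proof (rule ccontr)
  assume deg: "\<not> degree p \<le> n"
  have "(\<lambda>k. poly p (real k) / real k ^ degree p) \<longlonglongrightarrow> 0"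
  proof (rule Lim_null_comparison)
    have "(\<lambda>k. V * (1 / real k) ^ (degree p - n)) \<longlonglongrightarrow> V * 0 ^ (degree p - n)"
      by (intro tendsto_intros lim_1_over_n)
    moreover have "V * 0 ^ (degree p - n) = 0"
      using deg by simp
    ultimately show "(\<lambda>k. V * (1 / real k) ^ (degree p - n)) \<longlonglongrightarrow> 0"
      by (simp only:)
    show "\<forall>\<^sub>F k in sequentially. norm (poly p (real k) / real k ^ degree p) \<le> V * (1 / real k) ^ (degree p - n)"
      using assms eventually_gt_at_top[of 0]
    proof eventually_elim
      case (elim k)
      have "real k ^ degree p = real k ^ n * real k ^ (degree p - n)"
        using deg by (simp flip: power_add)
      with elim show ?case
        by (simp add: field_simps)
    qed
  qed
  then have "lead_coeff p = 0"
    using poly_over_lead_power_tendsto LIMSEQ_unique by blast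
  with deg show False by simp
qed

theorem theorem26:
  fixes A :: "real^'n^'m" and b c :: "real^'m"
  assumes "totally_unimodular A"
    and "\<forall>i. b $ i \<in> \<int>" and "\<forall>i. c $ i \<in> \<int>"
    and "bounded (polyP A b)"
  shows "\<exists>f :: real poly.
           degree f \<le> CARD('n) \<and>
           (\<exists>K::int. \<forall>k::int. k \<ge> K \<longrightarrow>
               real (latN A (of_int k *\<^sub>R b + c)) = poly f (of_int k)) \<and>
           ((aff_dim (polyP A b) = int CARD('n) \<and> (\<forall>i. \<exists>j. A $ i $ j \<noteq> 0)) \<longrightarrow>
               degree f = CARD('n) \<and> lead_coeff f = measure lebesgue (polyP A b))"
proof -
  let ?N = "\<lambda>k. real (latN A (real k *\<^sub>R b + c))"
  have int_eventually: "\<exists>K::int. \<forall>k\<ge>K. real (latN A (of_int k *\<^sub>R b + c)) = poly f (of_int k)"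
    if f: "\<forall>\<^sub>F k in sequentially. ?N k = poly f (real k)" for f
  proof -
    obtain K where K: "\<And>k. k \<ge> K \<Longrightarrow> ?N k = poly f (real k)"
      using f by (auto simp: eventually_sequentially)
    have "real (latN A (of_int k *\<^sub>R b + c)) = poly f (of_int k)" if "k \<ge> int K" for k
      using K[of "nat k"] that by simp
    then show ?thesis by blast
  qed
  show ?thesis
  proof (cases "polyP A b = {}")
    case True
    \<comment> \<open>In the empty case the zero polynomial works, and the dimension premise fails
      because the empty set has affine dimension -1.\<close>
    have "\<forall>\<^sub>F k in sequentially. ?N k = poly 0 (real k)"
      using eventually_polyP_empty[OF True, of c] by eventually_elim (simp add: latN_def)
    from int_eventually[OF this] show ?thesis
      using True by (intro exI[of _ 0]) simp
  next
    case False
    obtain M where "\<And>v x. x \<in> polyP A v \<Longrightarrow> norm x \<le> M * norm v"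
      using polyP_norm_le[OF assms(4) False] by blast
    \<comment> \<open>Boundedness for every right-hand side gives the finiteness of all
      representation sets and finite volume of all perturbed copies.\<close>
    then have bdd: "bounded (polyP A v)" for v
      unfolding bounded_iff by blast
    have "eventually_poly (\<lambda>k. real (card (reps (augcol A) UNIV (real k *\<^sub>R b + c))))"
      using totally_unimodular_augcol_integral[OF assms(1,2)]
      by (intro eventually_poly_card_reps finite_reps_augcol bdd) auto
    moreover have "latN A (real k *\<^sub>R b + c) = card (reps (augcol A) UNIV (real k *\<^sub>R b + c))" for k
      using assms(2,3) by (intro latN_eq_card_reps totally_unimodular_Ints[OF assms(1)]) auto
    ultimately obtain f where f: "\<forall>\<^sub>F k in sequentially. ?N k = poly f (real k)"
      unfolding eventually_poly_def by auto
    define C where "C = (\<Sum>i\<in>UNIV. \<Sum>j\<in>UNIV. \<bar>A $ i $ j\<bar>) + norm c"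
    have C: "C \<ge> 0"
      unfolding C_def by (intro add_nonneg_nonneg sum_nonneg) auto
    note bounds = latN_dilation_bounds[where A = A and b = b and c = c, OF bdd, folded C_def]
    have deg: "degree f \<le> CARD('n)"
    proof (rule degree_le_of_growth)
      show "\<forall>\<^sub>F k in sequentially. \<bar>poly f (real k)\<bar> \<le>
          real k ^ CARD('n) * measure lebesgue (polyP A (b + (\<chi> i. C)))"
        using f eventually_gt_at_top[of 0]
      proof eventually_elim
        case (elim k)
        have "\<bar>poly f (real k)\<bar> = ?N k"
          unfolding elim(1)[symmetric] by simp
        also have "\<dots> \<le> real k ^ CARD('n) * measure lebesgue (polyP A (b + (\<chi> i. C / real k)))"
          using elim by (intro bounds) simp
        \<comment> \<open>For \<open>k \<ge> 1\<close> the perturbation \<open>C / k\<close> is at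
          most \<open>C\<close>, which makes the volume factor independent of
          \<open>k\<close>.\<close>
        also have "\<dots> \<le> real k ^ CARD('n) * measure lebesgue (polyP A (b + (\<chi> i. C)))"
          using divide_left_mono[of 1 "real k" C] elim C
          by (intro mult_left_mono measure_polyP_mono bdd) auto
        finally show ?case .
      qed
    qed
    have "degree f = CARD('n) \<and> lead_coeff f = measure lebesgue (polyP A b)"
      if dim: "aff_dim (polyP A b) = int CARD('n)" and rows: "\<forall>i. \<exists>j. A $ i $ j \<noteq> 0"
    proof -
      have "(\<lambda>k. ?N (Suc k) / real (Suc k) ^ CARD('n)) \<longlonglongrightarrow> measure lebesgue (polyP A b)"
      proof (rule tendsto_sandwich)
        show "(\<lambda>k. measure lebesgue (polyP A (b - (\<chi> i. C / real (Suc k))))) \<longlonglongrightarrow> measure lebesgue (polyP A b)"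
        proof (rule measure_polyP_lower_limit[OF bdd C])
          show "A $ i \<noteq> 0" for i
            using rows[rule_format, of i] by auto
        qed
        show "(\<lambda>k. measure lebesgue (polyP A (b + (\<chi> i. C / real (Suc k))))) \<longlonglongrightarrow> measure lebesgue (polyP A b)"
          by (rule measure_polyP_upper_limit[OF bdd C])
        show "\<forall>\<^sub>F k in sequentially. measure lebesgue (polyP A (b - (\<chi> i. C / real (Suc k)))) \<le>
            ?N (Suc k) / real (Suc k) ^ CARD('n)"
          using bounds(2)[of "real (Suc _)"] by (simp add: field_simps del: of_nat_Suc)
        show "\<forall>\<^sub>F k in sequentially. ?N (Suc k) / real (Suc k) ^ CARD('n) \<le>
            measure lebesgue (polyP A (b + (\<chi> i. C / real (Suc k))))"
          using bounds(1)[of "real (Suc _)"] by (simp add: field_simps del: of_nat_Suc)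
      qed
      then have "(\<lambda>k. ?N k / real k ^ CARD('n)) \<longlonglongrightarrow> measure lebesgue (polyP A b)"
        by (rule LIMSEQ_imp_Suc)
      moreover have "(\<lambda>k. ?N k / real k ^ CARD('n)) \<longlonglongrightarrow> coeff f CARD('n)"
      proof (rule Lim_transform_eventually[OF poly_over_power_tendsto[OF deg]])
        show "\<forall>\<^sub>F k in sequentially. poly f (real k) / real k ^ CARD('n) = ?N k / real k ^ CARD('n)"
          using f by eventually_elim simp
      qed
      ultimately have coeff: "coeff f CARD('n) = measure lebesgue (polyP A b)"
        using LIMSEQ_unique by blast
      \<comment> \<open>Full dimension makes the volume positive, so the degree bound is
        attained.\<close>
      then have "coeff f CARD('n) \<noteq> 0"
        using measure_polyP_pos[OF bdd dim] by simp
      then have "degree f = CARD('n)"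
        using deg le_degree le_antisym by blast
      with coeff show ?thesis by simp
    qed
    with deg int_eventually[OF f] show ?thesis by blast
  qed
qed

end
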